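(* Let $\rho>0$ and $T\in C_\rho(H)$, and let $V$ be the minimal isometric $\rho$-dilation of $T$. Then $T$ is weakly stable if and only if $V$ is weakly stable.
   Context: $H$ is a complex Hilbert space and $B(H)$ is the algebra of bounded linear operators on $H$. For $\rho>0$, $C_\rho(H)$ (whose elements are called $\rho$-contractions) is the set of all $T\in B(H)$ admitting a unitary $\rho$-dilation: there are a Hilbert space $\mathcal{H}$ containing $H$ as a closed subspace and a unitary $U\in B(\mathcal{H})$ with $T^n=\rho P_H U^n|_H$ for all integers $n\ge 1$, where $P_H$ is the orthogonal projection of $\mathcal H$ onto $H$. The minimal isometric $\rho$-dilation of $T$ is the (unique up to unitary equivalence fixing $H$) isometry $V$ on a Hilbert space $K\supseteq H$ such that $T^n=\rho P_HV^n|_H$ for all $n\ge1$ and $K$ is the closed linear span of $\{V^nh: n\ge 0,\ h\in H\}$. An operator is weakly stable if its powers $T^n$ converge to $0$ in the weak operator topology as $n\to\infty$. *)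

theory Defs
  imports "HOL-Analysis.Analysis"
begin

section \<open>Complex Hilbert spaces\<close>

text \<open>The inner product is linear in the first and conjugate-linear in the second argument.
  Complex vector spaces carry the compatible real structure of the library class
  \<^class>\<open>real_normed_vector\<close>, so that its topology, limits and completeness can be used.\<close>

class complex_inner = real_normed_vector +
  fixes scaleC :: "complex \<Rightarrow> 'a \<Rightarrow> 'a"  (infixr \<open>*\<^sub>C\<close> 75)
    and cinner :: "'a \<Rightarrow> 'a \<Rightarrow> complex"
  assumes scaleC_add_right: "c *\<^sub>C (x + y) = c *\<^sub>C x + c *\<^sub>C y"
    and scaleC_add_left: "(c + d) *\<^sub>C x = c *\<^sub>C x + d *\<^sub>C x"
    and scaleC_scaleC: "c *\<^sub>C d *\<^sub>C x = (c * d) *\<^sub>C x"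
    and scaleC_one: "1 *\<^sub>C x = x"
    and scaleR_scaleC: "scaleR r x = complex_of_real r *\<^sub>C x"
    and cinner_commute: "cinner x y = cnj (cinner y x)"
    and cinner_add_left: "cinner (x + y) z = cinner x z + cinner y z"
    and cinner_scaleC_left: "cinner (c *\<^sub>C x) y = c * cinner x y"
    and cinner_ge_zero: "0 \<le> Re (cinner x x)"
    and cinner_eq_zero_iff: "cinner x x = 0 \<longleftrightarrow> x = 0"
    and norm_eq_sqrt_cinner: "norm x = sqrt (Re (cinner x x))"

class chilbert_space = complex_inner + complete_space

instantiation complex :: chilbert_space
begin

definition scaleC_complex :: "complex \<Rightarrow> complex \<Rightarrow> complex" where
  "scaleC_complex c x = c * x"

definition cinner_complex :: "complex \<Rightarrow> complex \<Rightarrow> complex" where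
  "cinner_complex x y = x * cnj y"

instance
proof
  fix x :: complex
  show "norm x = sqrt (Re (cinner x x))"
    by (simp add: cinner_complex_def cmod_def power2_eq_square)
qed (simp_all add: scaleC_complex_def cinner_complex_def algebra_simps scaleR_conv_of_real)

end

global_interpretation complex_vector: vector_space "scaleC :: complex \<Rightarrow> 'a \<Rightarrow> 'a::complex_inner"
  defines cspan = complex_vector.span
  by unfold_locales
    (simp_all add: scaleC_add_right scaleC_add_left scaleC_scaleC scaleC_one)


section \<open>Bounded operators\<close>

definition bounded_clinear :: "('a::complex_inner \<Rightarrow> 'b::complex_inner) \<Rightarrow> bool" where
  "bounded_clinear T \<longleftrightarrow> Vector_Spaces.linear scaleC scaleC T \<and> (\<exists>B. \<forall>x. norm (T x) \<le> norm x * B)"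

definition isometric_op :: "('a::complex_inner \<Rightarrow> 'b::complex_inner) \<Rightarrow> bool" where
  "isometric_op V \<longleftrightarrow> bounded_clinear V \<and> (\<forall>x. norm (V x) = norm x)"

definition unitary_op :: "('a::complex_inner \<Rightarrow> 'a) \<Rightarrow> bool" where
  "unitary_op U \<longleftrightarrow> bounded_clinear U \<and> bij U \<and> (\<forall>x y. cinner (U x) (U y) = cinner x y)"

text \<open>The orthogonal projection onto a closed subspace \<open>M\<close>.\<close>

definition orth_proj :: "'a::complex_inner set \<Rightarrow> 'a \<Rightarrow> 'a" where
  "orth_proj M x = (THE p. p \<in> M \<and> (\<forall>m\<in>M. cinner (x - p) m = 0))"

text \<open>The weak operator topology on the bounded operators: the initial topology for the maps
  sending \<open>T\<close> to \<open>cinner (T x) y\<close>.\<close>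

definition weak_operator_topology :: "('a::complex_inner \<Rightarrow> 'a) topology" where
  "weak_operator_topology =
     pullback_topology {T. bounded_clinear T} (\<lambda>T (x, y). cinner (T x) y)
       (product_topology (\<lambda>_. euclidean) UNIV)"

definition weakly_stable :: "('a::complex_inner \<Rightarrow> 'a) \<Rightarrow> bool" where
  "weakly_stable T \<longleftrightarrow> limitin weak_operator_topology (\<lambda>n. T ^^ n) (\<lambda>_. 0) sequentially"


section \<open>Dilations\<close>

text \<open>In all definitions below the inclusion of \<open>H\<close> as a closed subspace of a larger Hilbert space
  is represented by a linear isometry \<open>J\<close> between the two types; its range is closed because \<open>H\<close> is
  complete.\<close>

definition rho_dilation ::
  "real \<Rightarrow> ('h::chilbert_space \<Rightarrow> 'h) \<Rightarrow> ('h \<Rightarrow> 'k::chilbert_space) \<Rightarrow> ('k \<Rightarrow> 'k) \<Rightarrow> bool" where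
  "rho_dilation \<rho> T J W \<longleftrightarrow> isometric_op J \<and> bounded_clinear W \<and>
     (\<forall>n\<ge>1. \<forall>h. J ((T ^^ n) h) = \<rho> *\<^sub>R orth_proj (range J) ((W ^^ n) (J h)))"

text \<open>HOL cannot quantify existentially over types, so the type on which the unitary dilation lives
  is a parameter. A theorem assuming \<open>T \<in> rho_contractions TYPE('u) \<rho>\<close> with \<open>'u\<close> a type variable
  occurring nowhere else holds for every dilation space, as it does under an existential
  assumption.\<close>

definition rho_contractions :: "'u::chilbert_space itself \<Rightarrow> real \<Rightarrow> ('h::chilbert_space \<Rightarrow> 'h) set"
  where
  "rho_contractions _ \<rho> =
     {T. bounded_clinear T \<and> (\<exists>(J :: 'h \<Rightarrow> 'u) U. unitary_op U \<and> rho_dilation \<rho> T J U)}"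

definition minimal_isometric_rho_dilation ::
  "real \<Rightarrow> ('h::chilbert_space \<Rightarrow> 'h) \<Rightarrow> ('h \<Rightarrow> 'k::chilbert_space) \<Rightarrow> ('k \<Rightarrow> 'k) \<Rightarrow> bool" where
  "minimal_isometric_rho_dilation \<rho> T J V \<longleftrightarrow> isometric_op V \<and> rho_dilation \<rho> T J V \<and>
     closure (cspan {(V ^^ n) (J h) | n h. True}) = UNIV"

end

theory Submission
  imports Defs
begin

text \<open>Since \<open>V\<close> is an isometry, \<open>\<langle>V^(n+p) J h, V^q J g\<rangle> = \<langle>V^(n+p-q) J h, J g\<rangle> = \<langle>T^(n+p-q) h, g\<rangle> / \<rho>\<close>
  as soon as \<open>n + p > q\<close>. So the matrix coefficients of \<open>T^n\<close> are, up to the factor \<open>\<rho>\<close> and a shift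
  of \<open>n\<close>, those of \<open>V^n\<close> on the vectors \<open>V^p J h\<close>, whose span is dense by minimality; as the powers
  of \<open>V\<close> are uniformly bounded, convergence to zero extends from there to the whole space.\<close>

section \<open>Inner products\<close>

lemma cinner_zero_left [simp]: "cinner 0 y = 0"
  for y :: "'a::complex_inner"
  using cinner_add_left[of 0 0 y] by simp

lemma cinner_zero_right [simp]: "cinner x 0 = 0"
  for x :: "'a::complex_inner"
  by (subst cinner_commute) simp

lemma cinner_diff_left: "cinner (x - y) z = cinner x z - cinner y z"
  for x :: "'a::complex_inner"
  using cinner_add_left[of "x - y" y z] by simp

lemma cinner_add_right: "cinner x (y + z) = cinner x y + cinner x z"
  for x :: "'a::complex_inner"
  by (metis cinner_add_left cinner_commute complex_cnj_add)

lemma cinner_scaleC_right: "cinner x (c *\<^sub>C y) = cnj c * cinner x y"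
  for x :: "'a::complex_inner"
  by (metis cinner_commute cinner_scaleC_left complex_cnj_mult)

lemma cinner_scaleR_left: "cinner (r *\<^sub>R x) y = r *\<^sub>R cinner x y"
  for x :: "'a::complex_inner"
  by (simp add: scaleR_scaleC[of r x] cinner_scaleC_left scaleR_conv_of_real)

lemma cinner_self: "cinner x x = complex_of_real ((norm x)\<^sup>2)"
  for x :: "'a::complex_inner"
proof (rule complex_eqI)
  show "Re (cinner x x) = Re (complex_of_real ((norm x)\<^sup>2))"
    by (simp add: norm_eq_sqrt_cinner cinner_ge_zero)
  show "Im (cinner x x) = Im (complex_of_real ((norm x)\<^sup>2))"
    using arg_cong[OF cinner_commute[of x x], of Im] by simp
qed

lemma norm_add_sq: "(norm (x + y))\<^sup>2 = (norm x)\<^sup>2 + (norm y)\<^sup>2 + 2 * Re (cinner x y)"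
  for x :: "'a::complex_inner"
proof -
  have "Re (cinner y x) = Re (cinner x y)"
    by (subst cinner_commute) simp
  moreover have "(norm z)\<^sup>2 = Re (cinner z z)" for z :: 'a
    by (simp add: cinner_self)
  ultimately show ?thesis
    by (simp add: cinner_add_left cinner_add_right)
qed

lemma norm_diff_sq: "(norm (x - y))\<^sup>2 = (norm x)\<^sup>2 + (norm y)\<^sup>2 - 2 * Re (cinner x y)"
  for x :: "'a::complex_inner"
  using norm_add_sq[of "x - y" y] cinner_self[of y] by (simp add: cinner_diff_left)

text \<open>The class axioms tie the norm to complex scalars only through the inner product, so
  homogeneity is obtained by comparing squares.\<close>

lemma norm_scaleC: "norm (c *\<^sub>C x) = norm c * norm x"
  for x :: "'a::complex_inner"
proof (rule power2_eq_imp_eq)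
  have "complex_of_real ((norm (c *\<^sub>C x))\<^sup>2) = complex_of_real ((norm c * norm x)\<^sup>2)"
    unfolding cinner_self[symmetric] cinner_scaleC_left cinner_scaleC_right
    by (simp add: cinner_self power_mult_distrib complex_norm_square mult.assoc del: of_real_power)
  then show "(norm (c *\<^sub>C x))\<^sup>2 = (norm c * norm x)\<^sup>2"
    using of_real_eq_iff by blast
qed simp_all

text \<open>Pythagoras for the component of \<open>x\<close> along \<open>y\<close>. It serves both
  the Cauchy-Schwarz inequality and the orthogonality of the closest point.\<close>

lemma norm_diff_proj_sq:
  fixes x y :: "'a::complex_inner"
  assumes "y \<noteq> 0"
  shows "(norm (x - (cinner x y / cinner y y) *\<^sub>C y))\<^sup>2 = (norm x)\<^sup>2 - (norm (cinner x y) / norm y)\<^sup>2"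
proof -
  have "cnj (cinner x y / cinner y y) * cinner x y
      = complex_of_real ((norm (cinner x y) / norm y)\<^sup>2)"
    by (simp add: cinner_self power_divide complex_norm_square mult.commute del: of_real_power)
  moreover have "norm (cinner x y / cinner y y) * norm y = norm (cinner x y) / norm y"
    using assms by (simp add: cinner_self norm_divide norm_mult power2_eq_square)
  ultimately show ?thesis
    by (simp add: norm_diff_sq norm_scaleC cinner_scaleC_right del: complex_cnj_divide)
qed

lemma cinner_Cauchy_Schwarz: "norm (cinner x y) \<le> norm x * norm y"
  for x :: "'a::complex_inner"
proof (cases "y = 0")
  case False
  have "(norm (cinner x y) / norm y)\<^sup>2 \<le> (norm x)\<^sup>2"
    using norm_diff_proj_sq[OF False, of x] by (metis diff_ge_0_iff_ge zero_le_power2)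
  then have "norm (cinner x y) / norm y \<le> norm x"
    by (rule power2_le_imp_le) simp
  then show ?thesis
    using False by (simp add: divide_le_eq)
qed simp


section \<open>The projection theorem\<close>

text \<open>A sequence in \<open>M\<close> that minimizes the squared distance to \<open>x\<close>
  is Cauchy by the parallelogram law, since midpoints stay in \<open>M\<close>. Completeness gives
  its limit.\<close>

lemma closest_point_exists:
  fixes M :: "'a::chilbert_space set"
  assumes "closed M" "convex M" "M \<noteq> {}"
  obtains p where "p \<in> M" "\<And>m. m \<in> M \<Longrightarrow> norm (x - p) \<le> norm (x - m)"
proof -
  define D where "D = (INF m\<in>M. (norm (x - m))\<^sup>2)"
  have bdd: "bdd_below ((\<lambda>m. (norm (x - m))\<^sup>2) ` M)"
    by (intro bdd_belowI[of _ 0]) auto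
  have D_le: "D \<le> (norm (x - m))\<^sup>2" if "m \<in> M" for m
    unfolding D_def by (rule cINF_lower[OF bdd that])
  have "\<exists>m\<in>M. (norm (x - m))\<^sup>2 < D + inverse (real (Suc n))" for n
    using cINF_less_iff[OF assms(3) bdd, of "D + inverse (real (Suc n))"]
    by (simp add: D_def)
  then obtain a where a_mem: "\<And>n. a n \<in> M"
    and a_less: "\<And>n. (norm (x - a n))\<^sup>2 < D + inverse (real (Suc n))"
    by metis
  \<comment> \<open>Parallelogram law: the left side is twice the sum of the squared norms of
    \<open>?u\<close> and \<open>?v\<close>, less that of \<open>?u + ?v\<close>. The former is at
    most \<open>4 * D\<close> plus the error on the right, and the midpoint shows the latter to be
    at least \<open>4 * D\<close>.\<close>
  have near: "(norm (a m - a n))\<^sup>2 \<le> 4 * inverse (real (Suc N))" if "m \<ge> N" "n \<ge> N" for m n N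
  proof -
    let ?u = "x - a m" and ?v = "x - a n"
    have "(1/2) *\<^sub>R a m + (1/2) *\<^sub>R a n \<in> M"
      using convexD[OF assms(2) a_mem a_mem] by simp
    then have "D \<le> (norm (x - ((1/2) *\<^sub>R a m + (1/2) *\<^sub>R a n)))\<^sup>2"
      by (rule D_le)
    also have "x - ((1/2) *\<^sub>R a m + (1/2) *\<^sub>R a n) = (1/2) *\<^sub>R (?u + ?v)"
      using scaleR_half_double[of x] by (simp add: algebra_simps)
    finally have "4 * D \<le> (norm (?u + ?v))\<^sup>2"
      by (simp add: power_divide)
    moreover have "(norm (a m - a n))\<^sup>2 = (norm (?u - ?v))\<^sup>2"
      by (simp add: norm_minus_commute)
    moreover have "inverse (real (Suc m)) \<le> inverse (real (Suc N))"
      "inverse (real (Suc n)) \<le> inverse (real (Suc N))"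
      using that by (simp_all add: le_imp_inverse_le)
    ultimately show ?thesis
      using a_less[of m] a_less[of n] norm_add_sq[of ?u ?v] norm_diff_sq[of ?u ?v] by linarith
  qed
  have "Cauchy a"
    unfolding Cauchy_altdef2 dist_norm
  proof (intro allI impI)
    fix e :: real assume "e > 0"
    \<comment> \<open>The quarter absorbs the factor 4 in \<open>near\<close>.\<close>
    then obtain N where N: "inverse (real (Suc N)) < e\<^sup>2 / 4"
      using reals_Archimedean[of "e\<^sup>2 / 4"] by auto
    have "norm (a n - a N) < e" if "n \<ge> N" for n
      using near[OF that order.refl] N \<open>e > 0\<close> by (intro power_less_imp_less_base[of _ 2 e]) auto
    then show "\<exists>N. \<forall>n\<ge>N. norm (a n - a N) < e"
      by blast
  qed
  then obtain p where p: "a \<longlonglongrightarrow> p"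
    using Cauchy_convergent convergent_def by blast
  have "p \<in> M"
    using closed_sequentially[OF assms(1) _ p] a_mem by blast
  moreover have "(norm (x - p))\<^sup>2 \<le> D"
  proof (rule LIMSEQ_le)
    show "(\<lambda>n. (norm (x - a n))\<^sup>2) \<longlonglongrightarrow> (norm (x - p))\<^sup>2"
      by (intro tendsto_intros p)
    show "(\<lambda>n. D + inverse (real (Suc n))) \<longlonglongrightarrow> D"
      using tendsto_add[OF tendsto_const[of D] LIMSEQ_inverse_real_of_nat] by simp
    show "\<exists>N. \<forall>n\<ge>N. (norm (x - a n))\<^sup>2 \<le> D + inverse (real (Suc n))"
      using a_less less_imp_le by blast
  qed
  ultimately show ?thesis
    using that D_le power2_le_imp_le by (metis norm_ge_zero order_trans)
qed

text \<open>The point of \<open>M\<close> closest to \<open>x\<close> works: if \<open>x - p\<close>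
  had a nonzero component along some \<open>m\<close> in \<open>M\<close>, adding that component to
  \<open>p\<close> would give a strictly closer point of \<open>M\<close>.\<close>

lemma orthogonal_projection_exists:
  fixes M :: "'a::chilbert_space set"
  assumes "closed M" "complex_vector.subspace M"
  obtains p where "p \<in> M" "\<And>m. m \<in> M \<Longrightarrow> cinner (x - p) m = 0"
proof -
  have "convex M"
    using assms(2) unfolding convex_def scaleR_scaleC
    by (blast intro: complex_vector.subspace_add complex_vector.subspace_scale)
  moreover have "M \<noteq> {}"
    using complex_vector.subspace_0[OF assms(2)] by blast
  ultimately obtain p where p: "p \<in> M" "\<And>m. m \<in> M \<Longrightarrow> norm (x - p) \<le> norm (x - m)"
    using closest_point_exists[OF assms(1)] by blast
  have "cinner (x - p) m = 0" if "m \<in> M" for m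
  proof (cases "m = 0")
    case False
    let ?c = "cinner (x - p) m / cinner m m"
    have "p + ?c *\<^sub>C m \<in> M"
      by (intro complex_vector.subspace_add complex_vector.subspace_scale assms(2) p(1) that)
    from p(2)[OF this] have "(norm (x - p))\<^sup>2 \<le> (norm (x - p - ?c *\<^sub>C m))\<^sup>2"
      by (simp add: diff_diff_eq)
    also have "\<dots> = (norm (x - p))\<^sup>2 - (norm (cinner (x - p) m) / norm m)\<^sup>2"
      by (rule norm_diff_proj_sq[OF False])
    finally show ?thesis
      using False by simp
  qed simp
  with p(1) show ?thesis
    using that by blast
qed

text \<open>As \<open>orth_proj\<close> is a definite description, unique existence must come first.
  Two candidates differ by a vector of \<open>M\<close> that is orthogonal to itself, hence
  zero.\<close>

lemma cinner_orth_proj: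
  fixes M :: "'a::chilbert_space set"
  assumes "closed M" "complex_vector.subspace M" "m \<in> M"
  shows "cinner (orth_proj M x) m = cinner x m"
proof -
  have "\<exists>!p. p \<in> M \<and> (\<forall>m\<in>M. cinner (x - p) m = 0)"
  proof (rule ex_ex1I)
    show "\<exists>p. p \<in> M \<and> (\<forall>m\<in>M. cinner (x - p) m = 0)"
      using orthogonal_projection_exists[OF assms(1,2)] by metis
    fix p q
    assume p: "p \<in> M \<and> (\<forall>m\<in>M. cinner (x - p) m = 0)" and q: "q \<in> M \<and> (\<forall>m\<in>M. cinner (x - q) m = 0)"
    then have "p - q \<in> M"
      by (simp add: assms(2) complex_vector.subspace_diff)
    then have "cinner (x - q) (p - q) - cinner (x - p) (p - q) = 0"
      using p q by simp
    then have "cinner (p - q) (p - q) = 0"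
      by (simp add: cinner_diff_left)
    then show "p = q"
      by (simp add: cinner_eq_zero_iff)
  qed
  then have "orth_proj M x \<in> M \<and> (\<forall>m\<in>M. cinner (x - orth_proj M x) m = 0)"
    unfolding orth_proj_def by (rule theI')
  then show ?thesis
    using assms(3) by (simp add: cinner_diff_left)
qed


section \<open>Bounded operators and isometries\<close>

lemma bounded_clinear_add: "bounded_clinear T \<Longrightarrow> T (x + y) = T x + T y"
  by (auto simp: bounded_clinear_def Vector_Spaces.linear_iff)

lemma bounded_clinear_scaleC: "bounded_clinear T \<Longrightarrow> T (c *\<^sub>C x) = c *\<^sub>C T x"
  by (auto simp: bounded_clinear_def Vector_Spaces.linear_iff)

lemma bounded_clinear_imp_bounded_linear: "bounded_clinear T \<Longrightarrow> bounded_linear T"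
  unfolding bounded_clinear_def Vector_Spaces.linear_iff
  by (metis bounded_linear_intro scaleR_scaleC)

lemma bounded_clinearI:
  fixes T :: "'a::complex_inner \<Rightarrow> 'b::complex_inner"
  assumes "\<And>x y. T (x + y) = T x + T y" "\<And>c x. T (c *\<^sub>C x) = c *\<^sub>C T x"
    and "\<And>x. norm (T x) \<le> norm x * B"
  shows "bounded_clinear T"
  unfolding bounded_clinear_def Vector_Spaces.linear_iff
  using assms by (blast intro: complex_vector.vector_space_axioms)

lemma bounded_clinear_zero: "bounded_clinear (\<lambda>_. 0)"
  by (rule bounded_clinearI[where B = 0]) simp_all

lemma bounded_clinear_compose:
  assumes "bounded_clinear S" "bounded_clinear T"
  shows "bounded_clinear (S \<circ> T)"
proof -
  have "bounded_linear (\<lambda>x. S (T x))"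
    by (rule bounded_linear_compose[OF assms[THEN bounded_clinear_imp_bounded_linear]])
  then obtain B where "norm (S (T x)) \<le> norm x * B" for x
    using bounded_linear.bounded by blast
  then show ?thesis
    using assms
    by (intro bounded_clinearI[where B = B]) (auto simp: bounded_clinear_add bounded_clinear_scaleC)
qed

lemma bounded_clinear_funpow:
  fixes T :: "'a::complex_inner \<Rightarrow> 'a"
  shows "bounded_clinear T \<Longrightarrow> bounded_clinear (T ^^ n)"
proof (induction n)
  case 0
  show ?case
    by (rule bounded_clinearI[where B = 1]) simp_all
qed (auto intro: bounded_clinear_compose)

text \<open>Polarization: the norms of \<open>x\<close>, \<open>y\<close> and \<open>x + y\<close>
  determine the real part of the inner product, and replacing \<open>x\<close> by
  \<open>\<i> *\<^sub>C x\<close> recovers the imaginary part.\<close>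

lemma isometric_op_cinner:
  fixes V :: "'a::complex_inner \<Rightarrow> 'b::complex_inner"
  assumes "isometric_op V"
  shows "cinner (V x) (V y) = cinner x y"
proof -
  have V: "bounded_clinear V" "\<And>x. norm (V x) = norm x"
    using assms by (auto simp: isometric_op_def)
  have Re: "Re (cinner (V x) (V y)) = Re (cinner x y)" for x y
    using norm_add_sq[of "V x" "V y"] norm_add_sq[of x y] V(2)[of "x + y"]
    by (simp add: bounded_clinear_add[OF V(1)] V(2))
  from Re[of "\<i> *\<^sub>C x" y] Re[of x y] show ?thesis
    by (simp add: bounded_clinear_scaleC[OF V(1)] cinner_scaleC_left complex_eq_iff)
qed

lemma isometric_op_funpow:
  fixes V :: "'a::complex_inner \<Rightarrow> 'a"
  assumes "isometric_op V"
  shows "isometric_op (V ^^ n)"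
proof -
  have "norm ((V ^^ n) x) = norm x" for x
    using assms by (induction n) (auto simp: isometric_op_def)
  then show ?thesis
    using assms by (simp add: isometric_op_def bounded_clinear_funpow)
qed

text \<open>An isometric image of a complete space is complete, hence closed. Both facts are what
  the projection onto \<open>range J\<close> requires.\<close>

lemma
  fixes J :: "'a::chilbert_space \<Rightarrow> 'b::chilbert_space"
  assumes "isometric_op J"
  shows closed_range_isometric_op: "closed (range J)"
    and subspace_range_isometric_op: "complex_vector.subspace (range J)"
proof -
  have J: "bounded_clinear J" "\<And>x. norm (J x) = norm x"
    using assms by (auto simp: isometric_op_def)
  have "complete (range J)"
    by (rule complete_isometric_image[of 1])
       (auto simp: J complete_UNIV bounded_clinear_imp_bounded_linear)
  then show "closed (range J)"
    by (rule complete_imp_closed)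
  have "J 0 = 0"
    using J(2)[of 0] by simp
  then show "complex_vector.subspace (range J)"
    by (auto simp: complex_vector.subspace_def simp flip: bounded_clinear_add[OF J(1)]
        bounded_clinear_scaleC[OF J(1)] intro: range_eqI[of 0 J 0])
qed


section \<open>Weak stability\<close>

text \<open>The open sets are the preimages under \<open>g\<close> cut down to \<open>A\<close>, so
  convergence is tested after applying \<open>g\<close>, and the sequence must eventually lie in
  \<open>A\<close>.\<close>

lemma limitin_pullback_topology:
  "limitin (pullback_topology A g X) f l F \<longleftrightarrow>
     l \<in> A \<and> (\<forall>\<^sub>F n in F. f n \<in> A) \<and> limitin X (g \<circ> f) (g l) F"
    (is "?L \<longleftrightarrow> ?R")
proof
  assume L: ?L
  then have l: "l \<in> A" "g l \<in> topspace X"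
    by (auto simp: limitin_def topspace_pullback_topology)
  have ev: "\<forall>\<^sub>F n in F. f n \<in> g -` U \<inter> A" if "openin X U" "g l \<in> U" for U
    using that l by (intro limitinD[OF L]) (auto simp: openin_pullback_topology)
  have "\<forall>\<^sub>F n in F. f n \<in> A"
    using ev[OF openin_topspace l(2)] by (rule eventually_mono) blast
  moreover have "\<forall>\<^sub>F n in F. (g \<circ> f) n \<in> U" if "openin X U" "g l \<in> U" for U
    using ev[OF that] by (rule eventually_mono) simp
  ultimately show ?R
    using l by (auto simp: limitin_def)
next
  assume ?R
  then show ?L
    by (auto simp: limitin_def topspace_pullback_topology openin_pullback_topology
        eventually_conj_iff)
qed

text \<open>Limits in a product topology are taken coordinate by coordinate, and here the
  coordinates are the matrix coefficients.\<close>

lemma weakly_stable_iff: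
  fixes T :: "'a::complex_inner \<Rightarrow> 'a"
  assumes "bounded_clinear T"
  shows "weakly_stable T \<longleftrightarrow> (\<forall>x y. (\<lambda>n. cinner ((T ^^ n) x) y) \<longlonglongrightarrow> 0)"
  by (simp add: weakly_stable_def weak_operator_topology_def limitin_pullback_topology
      limitin_componentwise bounded_clinear_zero bounded_clinear_funpow[OF assms] o_def)

text \<open>Linearity carries the limit from \<open>S\<close> to its span. The bound
  \<open>C\<close>, uniform in \<open>n\<close>, then carries it to the closure by
  approximation.\<close>

lemma tendsto_zero_on_closure_cspan:
  fixes f :: "nat \<Rightarrow> 'a::complex_inner \<Rightarrow> complex"
  assumes add: "\<And>n x y. f n (x + y) = f n x + f n y"
    and scale: "\<And>n c x. f n (c *\<^sub>C x) = c * f n x"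
    and bound: "\<And>n x. norm (f n x) \<le> C * norm x"
    and lim: "\<And>x. x \<in> S \<Longrightarrow> (\<lambda>n. f n x) \<longlonglongrightarrow> 0"
    and x: "x \<in> closure (cspan S)"
  shows "(\<lambda>n. f n x) \<longlonglongrightarrow> 0"
proof -
  have span: "(\<lambda>n. f n y) \<longlonglongrightarrow> 0" if "y \<in> cspan S" for y
    using that
  proof (induction rule: complex_vector.span_induct_alt)
    case base
    have "f n 0 = 0" for n
      using bound[of n 0] by simp
    then show ?case
      by simp
  next
    case (step c y z)
    then show ?case
      using tendsto_add[OF tendsto_mult_right_zero[OF lim] step(2), of y c] by (simp add: add scale)
  qed
  show ?thesis
  proof (rule LIMSEQ_I)
    fix e :: real assume "e > 0"
    \<comment> \<open>Using \<open>\<bar>C\<bar> + 1\<close> keeps the denominator positive whatever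
      the sign of \<open>C\<close>; the approximation error is then below
      \<open>e / 2\<close>.\<close>
    define d where "d = e / (2 * (\<bar>C\<bar> + 1))"
    have "d > 0"
      using \<open>e > 0\<close> by (simp add: d_def add_nonneg_pos)
    then obtain y where y: "y \<in> cspan S" "norm (x - y) < d"
      using x unfolding closure_approachable by (metis dist_norm norm_minus_commute)
    obtain N where N: "norm (f n y) < e / 2" if "n \<ge> N" for n
      using LIMSEQ_D[OF span[OF y(1)], of "e / 2"] \<open>e > 0\<close> by auto
    have "norm (f n x - 0) < e" if "n \<ge> N" for n
    proof -
      have "norm (f n x) \<le> norm (f n (x - y)) + norm (f n y)"
        using norm_triangle_ineq[of "f n (x - y)" "f n y"] add[of n "x - y" y] by simp
      also have "norm (f n (x - y)) \<le> (\<bar>C\<bar> + 1) * norm (x - y)"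
        using bound[of n "x - y"] by (rule order_trans) (intro mult_right_mono, auto)
      also have "\<dots> \<le> (\<bar>C\<bar> + 1) * d"
        using y(2) by (intro mult_left_mono) auto
      also have "(\<bar>C\<bar> + 1) * d = e / 2"
        by (simp add: d_def field_simps)
      finally show ?thesis
        using N[OF that] by simp
    qed
    then show "\<exists>N. \<forall>n\<ge>N. norm (f n x - 0) < e"
      by blast
  qed
qed

text \<open>Apply \<open>J\<close> to both arguments. Since \<open>J g\<close> lies in
  \<open>range J\<close>, the projection disappears from the inner product.\<close>

lemma rho_dilation_cinner:
  assumes "rho_dilation \<rho> T J W" "n \<ge> 1"
  shows "cinner ((T ^^ n) h) g = \<rho> *\<^sub>R cinner ((W ^^ n) (J h)) (J g)"
proof -
  have J: "isometric_op J" and dil: "J ((T ^^ n) h) = \<rho> *\<^sub>R orth_proj (range J) ((W ^^ n) (J h))"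
    using assms by (auto simp: rho_dilation_def)
  have "cinner ((T ^^ n) h) g = cinner (J ((T ^^ n) h)) (J g)"
    by (simp add: isometric_op_cinner[OF J])
  also have "\<dots> = \<rho> *\<^sub>R cinner (orth_proj (range J) ((W ^^ n) (J h))) (J g)"
    by (simp add: dil cinner_scaleR_left)
  also have "\<dots> = \<rho> *\<^sub>R cinner ((W ^^ n) (J h)) (J g)"
    using J by (simp add: cinner_orth_proj closed_range_isometric_op subspace_range_isometric_op)
  finally show ?thesis .
qed

theorem lemma2p25:
  fixes \<rho> :: real
    and T :: "'h::chilbert_space \<Rightarrow> 'h"
    and J :: "'h \<Rightarrow> 'k::chilbert_space"
    and V :: "'k \<Rightarrow> 'k"
  assumes "\<rho> > 0"
    and "T \<in> rho_contractions TYPE('u::chilbert_space) \<rho>"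
    and "minimal_isometric_rho_dilation \<rho> T J V"
  shows "weakly_stable T \<longleftrightarrow> weakly_stable V"
proof -
  have T: "bounded_clinear T"
    using assms(2) by (simp add: rho_contractions_def)
  have V: "isometric_op V" and dil: "rho_dilation \<rho> T J V"
    and dense: "closure (cspan {(V ^^ n) (J h) | n h. True}) = UNIV"
    using assms(3) by (auto simp: minimal_isometric_rho_dilation_def)
  let ?S = "{(V ^^ n) (J h) | n h. True}"
  have Vlin: "bounded_clinear (V ^^ n)" and Vnorm: "norm ((V ^^ n) x) = norm x" for n x
    using isometric_op_funpow[OF V] by (auto simp: isometric_op_def)
  have "weakly_stable T \<longleftrightarrow> (\<forall>h g. (\<lambda>n. cinner ((T ^^ n) h) g) \<longlonglongrightarrow> 0)"
    by (rule weakly_stable_iff[OF T])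
  also have "\<dots> \<longleftrightarrow> (\<forall>h g. (\<lambda>n. cinner ((V ^^ n) (J h)) (J g)) \<longlonglongrightarrow> 0)"
  proof -
    have "(\<lambda>n. cinner ((T ^^ n) h) g) \<longlonglongrightarrow> 0 \<longleftrightarrow> (\<lambda>n. cinner ((V ^^ n) (J h)) (J g)) \<longlonglongrightarrow> 0" for h g
    proof -
      have "(\<lambda>n. cinner ((T ^^ n) h) g) \<longlonglongrightarrow> 0
          \<longleftrightarrow> (\<lambda>n. complex_of_real \<rho> * cinner ((V ^^ n) (J h)) (J g)) \<longlonglongrightarrow> 0"
        \<comment> \<open>The dilation identity starts at exponent 1; the term at 0 does not affect
          the limit.\<close>
        by (intro tendsto_cong eventually_sequentiallyI[of 1])
           (simp add: rho_dilation_cinner[OF dil] scaleR_conv_of_real)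
      also have "\<dots> \<longleftrightarrow> (\<lambda>n. cinner ((V ^^ n) (J h)) (J g)) \<longlonglongrightarrow> 0"
        using tendsto_mult_left_iff[of "complex_of_real \<rho>" _ 0] assms(1) by simp
      finally show ?thesis .
    qed
    then show ?thesis
      by blast
  qed
  also have "\<dots> \<longleftrightarrow> (\<forall>x y. (\<lambda>n. cinner ((V ^^ n) x) y) \<longlonglongrightarrow> 0)"
  proof (intro iffI allI)
    assume J: "\<forall>h g. (\<lambda>n. cinner ((V ^^ n) (J h)) (J g)) \<longlonglongrightarrow> 0"
    fix x y :: 'k
    \<comment> \<open>Shifting the index by \<open>q\<close> avoids subtracting exponents:
      \<open>V ^^ q\<close> can be pulled out of the left argument and cancelled against the one on
      the right.\<close>
    have gen: "(\<lambda>n. cinner ((V ^^ n) ((V ^^ p) (J h))) ((V ^^ q) (J g))) \<longlonglongrightarrow> 0" for p q h g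
    proof (rule LIMSEQ_offset)
      have "(V ^^ (n + q)) ((V ^^ p) (J h)) = (V ^^ q) ((V ^^ (n + p)) (J h))" for n
        by (simp add: ac_simps flip: funpow_add[THEN fun_cong, unfolded o_apply])
      then show "(\<lambda>n. cinner ((V ^^ (n + q)) ((V ^^ p) (J h))) ((V ^^ q) (J g))) \<longlonglongrightarrow> 0"
        using J by (simp add: isometric_op_cinner[OF isometric_op_funpow[OF V]])
           (rule LIMSEQ_ignore_initial_segment, blast)
    qed
    \<comment> \<open>Density is used one argument at a time: first the left one becomes arbitrary
      while the right one stays in \<open>?S\<close>.\<close>
    have left: "(\<lambda>n. cinner ((V ^^ n) x) y) \<longlonglongrightarrow> 0" if y: "y \<in> ?S" for x y
    proof (rule tendsto_zero_on_closure_cspan[of "\<lambda>n x. cinner ((V ^^ n) x) y" "norm y" ?S])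
      show "norm (cinner ((V ^^ n) x) y) \<le> norm y * norm x" for n x
        using cinner_Cauchy_Schwarz[of "(V ^^ n) x" y] by (simp add: Vnorm mult.commute)
    qed (use y gen dense in \<open>auto simp: bounded_clinear_add[OF Vlin] bounded_clinear_scaleC[OF Vlin]
           cinner_add_left cinner_scaleC_left\<close>)
    \<comment> \<open>The inner product is conjugate-linear in its second argument, so the arguments
      are swapped by conjugation to obtain a functional linear in \<open>y\<close>.\<close>
    have "(\<lambda>n. cinner y ((V ^^ n) x)) \<longlonglongrightarrow> 0"
    proof (rule tendsto_zero_on_closure_cspan[of "\<lambda>n y. cinner y ((V ^^ n) x)" "norm x" ?S])
      show "norm (cinner y ((V ^^ n) x)) \<le> norm x * norm y" for n y
        using cinner_Cauchy_Schwarz[of y "(V ^^ n) x"] by (simp add: Vnorm mult.commute)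
      show "(\<lambda>n. cinner y ((V ^^ n) x)) \<longlonglongrightarrow> 0" if "y \<in> ?S" for y
        using tendsto_cnj[OF left[OF that, of x]] by (simp flip: cinner_commute)
    qed (use dense in \<open>auto simp: cinner_add_left cinner_scaleC_left\<close>)
    from tendsto_cnj[OF this] show "(\<lambda>n. cinner ((V ^^ n) x) y) \<longlonglongrightarrow> 0"
      by (simp flip: cinner_commute)
  qed blast
  also have "\<dots> \<longleftrightarrow> weakly_stable V"
    using V by (simp add: weakly_stable_iff isometric_op_def)
  finally show ?thesis .
qed

end
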